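(* Let $G$ be a group and $m\ge3$ an integer. The following is a complete list of all normal subgroups of $G\wr\mathcal{S}_m$: (i) for each invariant normal subgroup $K\trianglelefteq G^m$: $$\{(k,1)\mid k\in K\}\trianglelefteq G\wr\mathcal{S}_m;$$ (ii) for each $N\trianglelefteq G$ with $G/N$ abelian, each non-trivial $Q\trianglelefteq\mathcal{S}_m$, and each homomorphism $\xi\colon Q\to G/N$: $$\{(g,q)\mid g\in G^m,\ q\in Q,\ (gK)\Xi=q\xi\}\trianglelefteq G\wr\mathcal{S}_m,$$ where $K=\{(g_1,\dots,g_m)\in G^m\mid g_1g_2\cdots g_m\in N\}$ and $\Xi\colon G^m/K\to G/N$ is defined by $(g_1,\dots,g_m)K\mapsto g_1\cdots g_mN$.
   Context: Permutations act on the right and are composed left to right. $G\wr\mathcal{S}_m$ is the set $G^m\times\mathcal{S}_m$ with multiplication $(g,\sigma)(h,\tau)=(gh_\sigma,\sigma\tau)$, where $h_\sigma=(h_{1\sigma},\dots,h_{m\sigma})$. A subgroup $K\le G^m$ is (permutation) invariant if for all $\sigma\in\mathcal{S}_m$, $(g_1,\dots,g_m)\in K\iff(g_{1\sigma},\dots,g_{m\sigma})\in K$. The map $\Xi$ in (ii) is an isomorphism.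
   Formalization: In (ii), for m = 3 and m = 4 only, ξ is also required to be constant on S_m-conjugacy classes in Q; without this the listed set need not be normal (e.g. m = 3, G = C_3, N = 1, Q = A_3, ξ an isomorphism). *)

theory Defs
  imports "HOL-Algebra.Algebra"
begin

(* Permutations act on the right and are composed from left to right: the image of i under
   sigma tau is tau (sigma i). The library's sym_group composes in the opposite order. *)
definition sym_lr :: "nat \<Rightarrow> (nat \<Rightarrow> nat) monoid"
  where "sym_lr m = (sym_group m) \<lparr> monoid.mult := (\<lambda>\<sigma> \<tau>. \<tau> \<circ> \<sigma>) \<rparr>"

abbreviation dpower :: "('a, 'b) monoid_scheme \<Rightarrow> nat \<Rightarrow> (nat \<Rightarrow> 'a) monoid"
  where "dpower G m \<equiv> product_group {1..m} (\<lambda>_. G)"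

(* The tuple (g_{1 sigma}, ..., g_{m sigma}). *)
definition permute_tuple :: "nat \<Rightarrow> (nat \<Rightarrow> 'a) \<Rightarrow> (nat \<Rightarrow> nat) \<Rightarrow> nat \<Rightarrow> 'a"
  where "permute_tuple m g \<sigma> = (\<lambda>i\<in>{1..m}. g (\<sigma> i))"

definition wreath_sym ::
    "('a, 'b) monoid_scheme \<Rightarrow> nat \<Rightarrow> ((nat \<Rightarrow> 'a) \<times> (nat \<Rightarrow> nat)) monoid"
  where "wreath_sym G m =
    \<lparr> carrier = carrier (dpower G m) \<times> carrier (sym_lr m),
      monoid.mult = (\<lambda>(g, \<sigma>) (h, \<tau>).
        (g \<otimes>\<^bsub>dpower G m\<^esub> permute_tuple m h \<sigma>, \<sigma> \<otimes>\<^bsub>sym_lr m\<^esub> \<tau>)),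
      one = (\<one>\<^bsub>dpower G m\<^esub>, \<one>\<^bsub>sym_lr m\<^esub>) \<rparr>"

definition perm_invariant :: "('a, 'b) monoid_scheme \<Rightarrow> nat \<Rightarrow> (nat \<Rightarrow> 'a) set \<Rightarrow> bool"
  where "perm_invariant G m K \<longleftrightarrow>
    (\<forall>\<sigma> \<in> carrier (sym_lr m). \<forall>g \<in> carrier (dpower G m). g \<in> K \<longleftrightarrow> permute_tuple m g \<sigma> \<in> K)"

(* The ordered product g_1 g_2 ... g_m; finprod is not usable since G need not be commutative. *)
definition tuple_prod :: "('a, 'b) monoid_scheme \<Rightarrow> nat \<Rightarrow> (nat \<Rightarrow> 'a) \<Rightarrow> 'a"
  where "tuple_prod G m g = foldr (\<otimes>\<^bsub>G\<^esub>) (map g [1..<Suc m]) \<one>\<^bsub>G\<^esub>"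

definition prod_in :: "('a, 'b) monoid_scheme \<Rightarrow> nat \<Rightarrow> 'a set \<Rightarrow> (nat \<Rightarrow> 'a) set"
  where "prod_in G m N = {g \<in> carrier (dpower G m). tuple_prod G m g \<in> N}"

(* The map Xi from G^m/K to G/N with K = prod_in G m N, sending the coset of g to the coset of
   g_1 ... g_m. As in the library's FactGroup_iso, the value on a coset C is the single element
   of the image of C; it is only meaningful when G/N is abelian. *)
definition Xi :: "('a, 'b) monoid_scheme \<Rightarrow> nat \<Rightarrow> 'a set \<Rightarrow> (nat \<Rightarrow> 'a) set \<Rightarrow> 'a set"
  where "Xi G m N C = the_elem ((\<lambda>g. N #>\<^bsub>G\<^esub> tuple_prod G m g) ` C)"

definition base_type_subgroup ::
    "nat \<Rightarrow> (nat \<Rightarrow> 'a) set \<Rightarrow> ((nat \<Rightarrow> 'a) \<times> (nat \<Rightarrow> nat)) set"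
  where "base_type_subgroup m K = {(k, \<one>\<^bsub>sym_lr m\<^esub>) | k. k \<in> K}"

definition hom_type_subgroup ::
    "('a, 'b) monoid_scheme \<Rightarrow> nat \<Rightarrow> 'a set \<Rightarrow> (nat \<Rightarrow> nat) set \<Rightarrow> ((nat \<Rightarrow> nat) \<Rightarrow> 'a set)
      \<Rightarrow> ((nat \<Rightarrow> 'a) \<times> (nat \<Rightarrow> nat)) set"
  where "hom_type_subgroup G m N Q \<xi> =
    {(g, q) | g q. g \<in> carrier (dpower G m) \<and> q \<in> Q \<and>
      Xi G m N (prod_in G m N #>\<^bsub>dpower G m\<^esub> g) = \<xi> q}"

(* Normality of hom_type_subgroup requires xi to take equal values on elements of Q that are
   conjugate in S_m, because g_1 ... g_m N is unchanged by permuting the tuple. For m >= 5 every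
   homomorphism from a normal subgroup Q of S_m to an abelian group has this property. For m = 3
   and m = 4 it can fail: take m = 3, Q = A_3, G cyclic of order 3, N trivial and xi an
   isomorphism, and conjugate by a transposition. *)
definition conj_invariant :: "nat \<Rightarrow> (nat \<Rightarrow> nat) set \<Rightarrow> ((nat \<Rightarrow> nat) \<Rightarrow> 'c) \<Rightarrow> bool"
  where "conj_invariant m Q \<xi> \<longleftrightarrow>
    (\<forall>\<tau> \<in> carrier (sym_lr m). \<forall>q \<in> Q.
      \<xi> (inv\<^bsub>sym_lr m\<^esub> \<tau> \<otimes>\<^bsub>sym_lr m\<^esub> q \<otimes>\<^bsub>sym_lr m\<^esub> \<tau>) = \<xi> q)"

end

theory Submission
  imports Defs
begin

text \<open>
  Write \<open>D\<close> for \<open>G\<^sup>m\<close>, \<open>S\<close> for the symmetric group and \<open>W\<close> for the wreath product, and let \<open>H\<close>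
  be a normal subgroup of \<open>W\<close>. If \<open>H\<close> lies in the base group, it is given by an invariant normal
  subgroup \<open>K\<close> of \<open>D\<close>, and conversely.

  Suppose instead that \<open>H\<close> contains some \<open>(g, \<sigma>)\<close> with \<open>\<sigma> \<noteq> id\<close>, and let \<open>p\<close> be the projection of
  \<open>W\<close> to \<open>A = W/H\<close>. Since \<open>(g, \<sigma>)\<close> dies in \<open>A\<close>, the element \<open>h\<close> of \<open>D\<close> has the same image as the
  conjugate of \<open>h\<^sub>\<sigma>\<close> by \<open>g\<close>. For a tuple \<open>h\<close> with a single nontrivial entry \<open>x\<close> at a position moved by
  \<open>\<sigma>\<close>, this moves the entry to another position \<open>i\<close>, at the price of conjugating it. A third position,
  which exists because \<open>m \<ge> 3\<close>, then shows that the image of such a tuple depends on \<open>x\<close> only and not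
  on the position (lemma \<open>single_tuple_hom_independent\<close>). Call it \<open>\<delta> x\<close>. Entries at different
  positions commute, so \<open>\<delta>\<close> is a homomorphism with commutative image, and multiplying up the entries
  of a tuple gives \<open>p (h, id) = \<delta> (h\<^sub>1 \<cdots> h\<^sub>m)\<close>. With \<open>N = ker \<delta>\<close>, the quotient \<open>G/N\<close> is abelian, and for
  a fixed permutation \<open>q\<close> the image of \<open>(h, q)\<close> in \<open>A\<close> is determined by the coset \<open>N h\<^sub>1 \<cdots> h\<^sub>m\<close>.
  So exactly one coset \<open>\<xi> q\<close> belongs to each \<open>q\<close> in the projection \<open>Q\<close> of \<open>H\<close> to \<open>S\<close>, and \<open>H\<close> is the
  subgroup defined by \<open>N\<close>, \<open>Q\<close> and \<open>\<xi>\<close> (lemma \<open>normal_wreath_not_base_is_hom_type\<close>).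

  Conversely, for \<open>G/N\<close> abelian, \<open>(h, q) \<mapsto> N h\<^sub>1 \<cdots> h\<^sub>m\<close> is a homomorphism on \<open>W\<close>, because in an
  abelian group permuting the factors does not change the product. Hence the subgroup defined by \<open>N\<close>,
  \<open>Q\<close>, \<open>\<xi>\<close> is normal as soon as \<open>\<xi>\<close> is constant on \<open>S\<close>-conjugates (lemma \<open>hom_type_subgroup_normal\<close>).
  For \<open>m \<ge> 5\<close> this is automatic: it suffices to conjugate \<open>q\<close> by a transposition \<open>t\<close>, and the quotient
  of \<open>t q t\<close> by \<open>q\<close> is a product of two transpositions that lies in \<open>Q\<close>. Such a product is trivial, a
  \<open>3\<close>-cycle or a product of two disjoint transpositions; when five points are available, a \<open>3\<close>-cycle
  in \<open>Q\<close> is a commutator of \<open>3\<close>-cycles in \<open>Q\<close>, so \<open>\<xi>\<close> kills it, and a double transposition is a product of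
  two such \<open>3\<close>-cycles.
\<close>

text \<open>
  Indices start at \<open>1\<close>; keeping this numeral folded lets the simplifier match \<open>{1..m}\<close> literally.
\<close>

declare One_nat_def [simp del]

section \<open>Commuting elements, normal subgroups and kernels\<close>

lemma (in comm_monoid) mult_interchange:
  assumes "x \<in> carrier G" "y \<in> carrier G" "u \<in> carrier G" "v \<in> carrier G"
  shows "(x \<otimes> y) \<otimes> (u \<otimes> v) = (x \<otimes> u) \<otimes> (y \<otimes> v)"
  using assms by (simp add: m_assoc m_lcomm)

context group
begin

lemma normal_conj_mem_iff:
  assumes N: "N \<lhd> G" and c: "x \<in> carrier G" "y \<in> carrier G" "z \<in> carrier G"
    and eq: "x \<otimes> y = z \<otimes> x"
  shows "y \<in> N \<longleftrightarrow> z \<in> N"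
proof -
  have z: "z = x \<otimes> y \<otimes> inv x" and y: "y = inv x \<otimes> z \<otimes> x"
    using c eq by (auto simp: m_assoc inv_solve_left)
  show ?thesis using N c y z
    by (metis normal.inv_op_closed1 normal.inv_op_closed2)
qed

text \<open>
  Normality checked through the commutation \<open>x y = z x\<close>, which avoids computing inverses in a
  group such as the wreath product where they are awkward.
\<close>

lemma normalI_conj:
  assumes N: "subgroup N G"
    and "\<And>x y. \<lbrakk>x \<in> carrier G; y \<in> N\<rbrakk> \<Longrightarrow> \<exists>z\<in>N. x \<otimes> y = z \<otimes> x"
  shows "N \<lhd> G"
  unfolding normal_inv_iff
proof (intro conjI ballI)
  fix x y assume xy: "x \<in> carrier G" "y \<in> N"
  then obtain z where z: "z \<in> N" "x \<otimes> y = z \<otimes> x" using assms by blast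
  then have "z \<in> carrier G" using N subgroup.subset by blast
  then show "x \<otimes> y \<otimes> inv x \<in> N" using z xy by (simp add: m_assoc)
qed (fact N)

lemma kernel_coset_eq_iff:
  assumes "group A" "\<delta> \<in> hom G A" "x \<in> carrier G" "y \<in> carrier G"
  shows "kernel G A \<delta> #> x = kernel G A \<delta> #> y \<longleftrightarrow> \<delta> x = \<delta> y"
proof -
  interpret \<delta>: group_hom G A \<delta>
    by (rule group_hom.intro) (use assms in \<open>auto simp: group_hom_axioms_def\<close>)
  have "\<delta> x = \<delta> y" if "kernel G A \<delta> #> x = kernel G A \<delta> #> y"
  proof -
    have "x \<in> kernel G A \<delta> #> y"
      using that rcos_self[OF assms(3) \<delta>.subgroup_kernel] by simp
    then obtain n where "n \<in> kernel G A \<delta>" "x = n \<otimes> y" by (auto simp: r_coset_def)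
    then show ?thesis using assms by (simp add: kernel_def)
  qed
  then show ?thesis
    using \<delta>.FactGroup_subset[OF assms(3,4)] \<delta>.FactGroup_subset[OF assms(4,3)] by auto
qed

text \<open>
  The quotient is a copy of the image of \<open>\<delta>\<close>, so commuting values of \<open>\<delta>\<close> suffice. In the application
  \<open>A\<close> is a quotient of the wreath product and in general not commutative.
\<close>

lemma comm_group_Mod_kernel:
  assumes "group A" "\<delta> \<in> hom G A"
    and comm: "\<And>x y. \<lbrakk>x \<in> carrier G; y \<in> carrier G\<rbrakk> \<Longrightarrow> \<delta> x \<otimes>\<^bsub>A\<^esub> \<delta> y = \<delta> y \<otimes>\<^bsub>A\<^esub> \<delta> x"
  shows "comm_group (G Mod kernel G A \<delta>)"
proof -
  interpret \<delta>: group_hom G A \<delta>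
    by (rule group_hom.intro) (use assms in \<open>auto simp: group_hom_axioms_def\<close>)
  interpret N: normal "kernel G A \<delta>" G by (rule \<delta>.normal_kernel)
  show ?thesis
  proof (rule group.group_comm_groupI[OF N.factorgroup_is_group])
    fix C D assume "C \<in> carrier (G Mod kernel G A \<delta>)" "D \<in> carrier (G Mod kernel G A \<delta>)"
    then obtain x y where xy: "x \<in> carrier G" "y \<in> carrier G"
      "C = kernel G A \<delta> #> x" "D = kernel G A \<delta> #> y"
      by (auto simp: carrier_FactGroup)
    then show "C \<otimes>\<^bsub>G Mod kernel G A \<delta>\<^esub> D = D \<otimes>\<^bsub>G Mod kernel G A \<delta>\<^esub> C"
      using comm[OF xy(1,2)] by (simp add: N.rcos_sum kernel_coset_eq_iff[OF assms(1,2)])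
  qed
qed

end

section \<open>The symmetric group with composition from left to right\<close>

lemma carrier_sym_lr [simp]: "carrier (sym_lr m) = {p. p permutes {1..m}}"
  by (simp add: sym_lr_def sym_group_def)

lemma mult_sym_lr [simp]: "\<sigma> \<otimes>\<^bsub>sym_lr m\<^esub> \<tau> = \<tau> \<circ> \<sigma>"
  by (simp add: sym_lr_def)

lemma one_sym_lr [simp]: "\<one>\<^bsub>sym_lr m\<^esub> = id"
  by (simp add: sym_lr_def sym_group_def)

lemma group_sym_lr [simp]: "group (sym_lr m)"
proof (rule groupI)
  fix \<sigma> assume "\<sigma> \<in> carrier (sym_lr m)"
  then show "\<exists>\<tau>\<in>carrier (sym_lr m). \<tau> \<otimes>\<^bsub>sym_lr m\<^esub> \<sigma> = \<one>\<^bsub>sym_lr m\<^esub>"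
    by (intro bexI[of _ "inv' \<sigma>"]) (auto simp: permutes_inv permutes_inv_o)
qed (auto simp: permutes_compose permutes_id o_assoc)

lemma inv_sym_lr:
  assumes "\<sigma> permutes {1..m}"
  shows "inv\<^bsub>sym_lr m\<^esub> \<sigma> = inv' \<sigma>"
  using assms by (intro group.inv_equality) (auto simp: permutes_inv permutes_inv_o)

lemma exists_fresh_index:
  assumes "finite F" "card F < m"
  obtains d where "d \<in> {1..m}" "d \<notin> F"
proof -
  have "\<not> {1..m} \<subseteq> F" using card_mono[OF assms(1), of "{1..m}"] assms(2) by auto
  then show thesis using that by blast
qed

section \<open>Permuted tuples and their products\<close>

context group
begin

lemma group_dpower [simp]: "group (dpower G m)"
  by simp

lemma permute_tuple_closed [simp]:
  assumes "g \<in> carrier (dpower G m)" "\<sigma> permutes {1..m}"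
  shows "permute_tuple m g \<sigma> \<in> carrier (dpower G m)"
  using assms permutes_in_image[OF assms(2)] by (auto simp: permute_tuple_def PiE_iff)

lemma permute_tuple_mult:
  assumes "\<sigma> permutes {1..m}"
  shows "permute_tuple m (g \<otimes>\<^bsub>dpower G m\<^esub> h) \<sigma> =
         permute_tuple m g \<sigma> \<otimes>\<^bsub>dpower G m\<^esub> permute_tuple m h \<sigma>"
  using permutes_in_image[OF assms] by (auto simp: permute_tuple_def fun_eq_iff)

lemma permute_tuple_permute_tuple:
  assumes "\<sigma> permutes {1..m}"
  shows "permute_tuple m (permute_tuple m g \<tau>) \<sigma> = permute_tuple m g (\<tau> \<circ> \<sigma>)"
  using permutes_in_image[OF assms] by (auto simp: permute_tuple_def fun_eq_iff)

lemma permute_tuple_id [simp]: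
  assumes "g \<in> carrier (dpower G m)"
  shows "permute_tuple m g id = g"
  using assms by (auto simp: permute_tuple_def PiE_iff extensional_def fun_eq_iff)

lemma permute_tuple_one [simp]:
  assumes "\<sigma> permutes {1..m}"
  shows "permute_tuple m \<one>\<^bsub>dpower G m\<^esub> \<sigma> = \<one>\<^bsub>dpower G m\<^esub>"
  using permutes_in_image[OF assms] by (auto simp: permute_tuple_def fun_eq_iff)

lemma tuple_prod_closed:
  assumes "g \<in> carrier (dpower G m)"
  shows "tuple_prod G m g \<in> carrier G"
proof -
  have "foldr (\<otimes>) (map g xs) \<one> \<in> carrier G" if "set xs \<subseteq> {1..m}" for xs
    using that assms by (induction xs) (auto simp: PiE_iff)
  from this[of "[1..<Suc m]"] show ?thesis
    unfolding tuple_prod_def by (simp add: atLeastLessThanSuc_atLeastAtMost del: upt_Suc)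
qed

text \<open>
  In a commutative group the order of the factors is irrelevant, so the image of the ordered product
  becomes a product over an index set, where multiplicativity and reindexing by a permutation are
  available.
\<close>

lemma hom_tuple_prod_eq_finprod:
  assumes A: "comm_group A" and f: "f \<in> hom G A" and g: "g \<in> carrier (dpower G m)"
  shows "f (tuple_prod G m g) = finprod A (\<lambda>i. f (g i)) {1..m}"
proof -
  interpret A: comm_group A by fact
  interpret f: group_hom G A f by (rule group_hom.intro) (auto simp: group_hom_axioms_def f)
  have gc: "g i \<in> carrier G" if "i \<in> {1..m}" for i using g that by (auto simp: PiE_iff)
  have "foldr (\<otimes>) (map g xs) \<one> \<in> carrier G \<and>
        f (foldr (\<otimes>) (map g xs) \<one>) = finprod A (\<lambda>i. f (g i)) (set xs)"
    if "set xs \<subseteq> {1..m}" "distinct xs" for xs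
    using that by (induction xs) (auto simp: gc Pi_iff subset_iff)
  from this[of "[1..<Suc m]"] show ?thesis
    unfolding tuple_prod_def by (simp add: atLeastLessThanSuc_atLeastAtMost del: upt_Suc)
qed

text \<open>
  The embedding of \<open>G\<close> as the \<open>j\<close>-th factor of \<open>G\<^sup>m\<close>.
\<close>

definition single_tuple :: "nat \<Rightarrow> nat \<Rightarrow> 'a \<Rightarrow> nat \<Rightarrow> 'a"
  where "single_tuple m j x = (\<lambda>i\<in>{1..m}. if i = j then x else \<one>)"

lemma single_tuple_closed [simp]:
  "x \<in> carrier G \<Longrightarrow> single_tuple m j x \<in> carrier (dpower G m)"
  by (auto simp: single_tuple_def)

lemma single_tuple_mult:
  assumes "x \<in> carrier G" "y \<in> carrier G"
  shows "single_tuple m j (x \<otimes> y) = single_tuple m j x \<otimes>\<^bsub>dpower G m\<^esub> single_tuple m j y"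
  using assms by (auto simp: single_tuple_def fun_eq_iff)

lemma single_tuple_commute:
  assumes "x \<in> carrier G" "y \<in> carrier G" "j \<noteq> l"
  shows "single_tuple m j x \<otimes>\<^bsub>dpower G m\<^esub> single_tuple m l y =
         single_tuple m l y \<otimes>\<^bsub>dpower G m\<^esub> single_tuple m j x"
  using assms by (auto simp: single_tuple_def fun_eq_iff)

text \<open>
  The entry is found at position \<open>\<sigma> j\<close> of the original tuple, so acting by \<open>\<sigma>\<close> moves
  it backwards, to \<open>j\<close>.
\<close>

lemma permute_single_tuple:
  assumes "\<sigma> permutes {1..m}"
  shows "permute_tuple m (single_tuple m (\<sigma> j) x) \<sigma> = single_tuple m j x"
  using permutes_in_image[OF assms] permutes_inj[OF assms]
  by (auto simp: permute_tuple_def single_tuple_def fun_eq_iff inj_eq)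

lemma conj_single_tuple:
  assumes "g \<in> carrier (dpower G m)" "x \<in> carrier G" "i \<in> {1..m}"
  shows "g \<otimes>\<^bsub>dpower G m\<^esub> single_tuple m i x =
         single_tuple m i (g i \<otimes> x \<otimes> inv (g i)) \<otimes>\<^bsub>dpower G m\<^esub> g"
proof -
  have g: "g l \<in> carrier G" if "l \<in> {1..m}" for l
    using assms(1) that by (auto simp: PiE_iff)
  then have "g i \<otimes> x \<otimes> inv (g i) \<otimes> g i = g i \<otimes> x"
    using assms by (simp add: m_assoc)
  then show ?thesis
    using g by (auto simp: single_tuple_def fun_eq_iff)
qed

text \<open>
  A tuple is the product of its single entries in their natural order, so a homomorphism on
  \<open>G\<^sup>m\<close> is determined by its values on the factors.
\<close>

lemma hom_eq_foldr_single_tuple: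
  assumes A: "group A" and c: "c \<in> hom (dpower G m) A" and g: "g \<in> carrier (dpower G m)"
  shows "c g = foldr (\<otimes>\<^bsub>A\<^esub>) (map (\<lambda>j. c (single_tuple m j (g j))) [1..<Suc m]) \<one>\<^bsub>A\<^esub>"
proof -
  interpret c: group_hom "dpower G m" A c
    by (rule group_hom.intro) (auto simp: group_hom_axioms_def c A)
  \<comment> \<open>the tuple \<open>g\<close> restricted to the positions in a list; the induction adds one position at a time\<close>
  define part where "part xs = (\<lambda>i\<in>{1..m}. if i \<in> set xs then g i else \<one>)" for xs :: "nat list"
  have part: "part xs \<in> carrier (dpower G m)" for xs
    using g by (auto simp: part_def PiE_iff)
  have "c (part xs) = foldr (\<otimes>\<^bsub>A\<^esub>) (map (\<lambda>j. c (single_tuple m j (g j))) xs) \<one>\<^bsub>A\<^esub>"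
    if "set xs \<subseteq> {1..m}" "distinct xs" for xs
    using that
  proof (induction xs)
    case Nil
    have "part [] = \<one>\<^bsub>dpower G m\<^esub>" by (simp add: part_def)
    then show ?case using c.hom_one by (simp del: one_product_group)
  next
    case (Cons j xs)
    have gj: "g j \<in> carrier G" using g Cons.prems by (auto simp: PiE_iff)
    have "part (j # xs) = single_tuple m j (g j) \<otimes>\<^bsub>dpower G m\<^esub> part xs"
      using g Cons.prems by (auto simp: part_def single_tuple_def fun_eq_iff PiE_iff)
    then have "c (part (j # xs)) = c (single_tuple m j (g j)) \<otimes>\<^bsub>A\<^esub> c (part xs)"
      using c.hom_mult[OF single_tuple_closed[OF gj] part] by metis
    then show ?case using Cons by simp
  qed
  from this[of "[1..<Suc m]"] have
    "c (part [1..<Suc m]) = foldr (\<otimes>\<^bsub>A\<^esub>) (map (\<lambda>j. c (single_tuple m j (g j))) [1..<Suc m]) \<one>\<^bsub>A\<^esub>"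
    by (simp add: atLeastLessThanSuc_atLeastAtMost del: upt_Suc)
  moreover have "part [1..<Suc m] = g"
    using g by (auto simp: part_def fun_eq_iff PiE_iff extensional_def)
  ultimately show ?thesis by simp
qed

section \<open>The wreath product\<close>

lemma carrier_wreath [simp]:
  "carrier (wreath_sym G m) = carrier (dpower G m) \<times> {\<sigma>. \<sigma> permutes {1..m}}"
  by (simp add: wreath_sym_def)

lemma mult_wreath [simp]:
  "(g, \<sigma>) \<otimes>\<^bsub>wreath_sym G m\<^esub> (h, \<tau>) = (g \<otimes>\<^bsub>dpower G m\<^esub> permute_tuple m h \<sigma>, \<tau> \<circ> \<sigma>)"
  by (simp add: wreath_sym_def)

lemma one_wreath [simp]: "\<one>\<^bsub>wreath_sym G m\<^esub> = (\<one>\<^bsub>dpower G m\<^esub>, id)"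
  by (simp add: wreath_sym_def)

lemma group_wreath [simp]: "group (wreath_sym G m)"
proof -
  interpret D: group "dpower G m" by simp
  note [simp del] = carrier_product_group one_product_group mult_product_group
  show ?thesis
  proof (rule groupI)
    fix x assume x: "x \<in> carrier (wreath_sym G m)"
    obtain g \<sigma> where [simp]: "x = (g, \<sigma>)" and g: "g \<in> carrier (dpower G m)" and \<sigma>: "\<sigma> permutes {1..m}"
      using x by auto
    let ?h = "permute_tuple m (inv\<^bsub>dpower G m\<^esub> g) (inv' \<sigma>)"
    have "?h \<otimes>\<^bsub>dpower G m\<^esub> permute_tuple m g (inv' \<sigma>) = \<one>\<^bsub>dpower G m\<^esub>"
      using g \<sigma> by (simp add: permute_tuple_mult[symmetric] permutes_inv)
    then show "\<exists>y\<in>carrier (wreath_sym G m). y \<otimes>\<^bsub>wreath_sym G m\<^esub> x = \<one>\<^bsub>wreath_sym G m\<^esub>"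
      using g \<sigma> by (intro bexI[of _ "(?h, inv' \<sigma>)"]) (auto simp: permutes_inv permutes_inv_o)
  qed (auto simp: permutes_compose permutes_id permute_tuple_mult permute_tuple_permute_tuple
        o_assoc D.m_assoc)
qed

lemma snd_hom_wreath: "snd \<in> hom (wreath_sym G m) (sym_lr m)"
  by (auto simp: hom_def)

lemma hom_base_wreath: "(\<lambda>k. (k, id)) \<in> hom (dpower G m) (wreath_sym G m)"
  by (auto simp: hom_def permutes_id simp del: mult_product_group carrier_product_group)

text \<open>
  Together with the next lemma this reduces calculations in the wreath product to the base
  group and the pure permutations: it is their product, and the latter act by permuting entries.
\<close>

lemma wreath_eq_base_times_perm:
  assumes "g \<in> carrier (dpower G m)" "\<sigma> permutes {1..m}"
  shows "(g, \<sigma>) = (g, id) \<otimes>\<^bsub>wreath_sym G m\<^esub> (\<one>\<^bsub>dpower G m\<^esub>, \<sigma>)"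
proof -
  interpret D: group "dpower G m" by simp
  show ?thesis
    using assms by (simp add: D.one_closed del: one_product_group mult_product_group carrier_product_group)
qed

lemma wreath_perm_conj_base:
  assumes "h \<in> carrier (dpower G m)" "\<sigma> permutes {1..m}"
  shows "(\<one>\<^bsub>dpower G m\<^esub>, \<sigma>) \<otimes>\<^bsub>wreath_sym G m\<^esub> (h, id) =
         (permute_tuple m h \<sigma>, id) \<otimes>\<^bsub>wreath_sym G m\<^esub> (\<one>\<^bsub>dpower G m\<^esub>, \<sigma>)"
proof -
  interpret D: group "dpower G m" by simp
  show ?thesis
    using assms
    by (simp add: D.one_closed del: one_product_group mult_product_group carrier_product_group)
qed

section \<open>Subgroups of the base group\<close>

text \<open>
  Conjugating \<open>k\<close> by \<open>(g, \<sigma>)\<close> first permutes \<open>k\<close> by \<open>\<sigma>\<close> and then conjugates by \<open>g\<close>; invariance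
  and normality of \<open>K\<close> handle one step each.
\<close>

lemma base_type_subgroup_normal:
  assumes K: "K \<lhd> dpower G m" and inv: "perm_invariant G m K"
  shows "base_type_subgroup m K \<lhd> wreath_sym G m"
proof -
  interpret D: group "dpower G m" by simp
  interpret W: group "wreath_sym G m" by simp
  interpret i: group_hom "dpower G m" "wreath_sym G m" "\<lambda>k. (k, id)"
    by (rule group_hom.intro) (auto simp: group_hom_axioms_def hom_base_wreath)
  note [simp del] = i.hom_mult i.hom_inv i.hom_one
  note [simp del] = carrier_product_group one_product_group mult_product_group
  have KD: "subgroup K (dpower G m)" "K \<subseteq> carrier (dpower G m)"
    using K normal_imp_subgroup subgroup.subset by blast+
  have eq: "base_type_subgroup m K = (\<lambda>k. (k, id)) ` K"
    by (auto simp: base_type_subgroup_def)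
  show ?thesis unfolding eq
  proof (rule W.normalI_conj)
    show "subgroup ((\<lambda>k. (k, id)) ` K) (wreath_sym G m)"
      using i.subgroup_img_is_subgroup[OF KD(1)] .
    fix x y assume x: "x \<in> carrier (wreath_sym G m)" and y: "y \<in> (\<lambda>k. (k, id :: nat \<Rightarrow> nat)) ` K"
    obtain g \<sigma> where [simp]: "x = (g, \<sigma>)" and g: "g \<in> carrier (dpower G m)" and \<sigma>: "\<sigma> permutes {1..m}"
      using x by auto
    obtain k where [simp]: "y = (k, id)" and k: "k \<in> K" using y by auto
    have kD: "k \<in> carrier (dpower G m)" using k KD by auto
    define k' where "k' = permute_tuple m k \<sigma>"
    have k': "k' \<in> K" "k' \<in> carrier (dpower G m)"
      using inv k kD \<sigma> by (auto simp: perm_invariant_def k'_def)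
    let ?z = "g \<otimes>\<^bsub>dpower G m\<^esub> k' \<otimes>\<^bsub>dpower G m\<^esub> inv\<^bsub>dpower G m\<^esub> g"
    have z: "?z \<in> K" using K k' g by (metis normal.inv_op_closed2)
    then have "?z \<in> carrier (dpower G m)" using KD by auto
    moreover have "?z \<otimes>\<^bsub>dpower G m\<^esub> g = g \<otimes>\<^bsub>dpower G m\<^esub> k'"
      using g k' by (simp add: D.m_assoc)
    ultimately have "x \<otimes>\<^bsub>wreath_sym G m\<^esub> y = (?z, id) \<otimes>\<^bsub>wreath_sym G m\<^esub> x"
      using g by (simp add: k'_def)
    then show "\<exists>z\<in>(\<lambda>k. (k, id)) ` K. x \<otimes>\<^bsub>wreath_sym G m\<^esub> y = z \<otimes>\<^bsub>wreath_sym G m\<^esub> x"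
      using z by blast
  qed
qed

lemma normal_wreath_base_part:
  assumes H: "H \<lhd> wreath_sym G m"
  defines "K \<equiv> {k. (k, id) \<in> H}"
  shows "K \<lhd> dpower G m" and "perm_invariant G m K"
proof -
  interpret D: group "dpower G m" by simp
  interpret W: group "wreath_sym G m" by simp
  note [simp del] = carrier_product_group one_product_group mult_product_group
  interpret i: group_hom "dpower G m" "wreath_sym G m" "\<lambda>k. (k, id)"
    by (rule group_hom.intro) (auto simp: group_hom_axioms_def hom_base_wreath)
  note [simp del] = i.hom_mult i.hom_inv i.hom_one
  interpret H: normal H "wreath_sym G m" by fact
  have HW: "H \<subseteq> carrier (wreath_sym G m)" by (rule H.subset)
  have KD: "K \<subseteq> carrier (dpower G m)" using HW by (auto simp: K_def)
  have inv_base: "(inv\<^bsub>dpower G m\<^esub> a, id) = inv\<^bsub>wreath_sym G m\<^esub> (a, id)"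
    if "a \<in> carrier (dpower G m)" for a
    using that by (rule i.hom_inv)
  have mult_base: "(a \<otimes>\<^bsub>dpower G m\<^esub> b, id) = (a, id) \<otimes>\<^bsub>wreath_sym G m\<^esub> (b, id)"
    if "a \<in> carrier (dpower G m)" "b \<in> carrier (dpower G m)" for a b
    using that by (rule i.hom_mult)
  show "K \<lhd> dpower G m"
    unfolding D.normal_inv_iff
  proof (intro conjI ballI)
    show "subgroup K (dpower G m)"
    proof (rule D.subgroupI)
      show "K \<noteq> {}" using H.one_closed by (auto simp: K_def)
      show "inv\<^bsub>dpower G m\<^esub> a \<in> K" if "a \<in> K" for a
      proof -
        have "(a, id) \<in> H" "a \<in> carrier (dpower G m)" using that KD by (auto simp: K_def)
        then show ?thesis unfolding K_def mem_Collect_eq using inv_base[of a] H.m_inv_closed by simp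
      qed
      show "a \<otimes>\<^bsub>dpower G m\<^esub> b \<in> K" if "a \<in> K" "b \<in> K" for a b
      proof -
        have "(a, id) \<in> H" "(b, id) \<in> H" "a \<in> carrier (dpower G m)" "b \<in> carrier (dpower G m)"
          using that KD by (auto simp: K_def)
        then show ?thesis
          unfolding K_def mem_Collect_eq using H.m_closed mult_base[of a b] by metis
      qed
    qed (fact KD)
    show "x \<otimes>\<^bsub>dpower G m\<^esub> k \<otimes>\<^bsub>dpower G m\<^esub> inv\<^bsub>dpower G m\<^esub> x \<in> K"
      if "x \<in> carrier (dpower G m)" "k \<in> K" for x k
    proof -
      have kD: "k \<in> carrier (dpower G m)" using that KD by auto
      have "(x \<otimes>\<^bsub>dpower G m\<^esub> k \<otimes>\<^bsub>dpower G m\<^esub> inv\<^bsub>dpower G m\<^esub> x, id) =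
        (x, id) \<otimes>\<^bsub>wreath_sym G m\<^esub> (k, id) \<otimes>\<^bsub>wreath_sym G m\<^esub> inv\<^bsub>wreath_sym G m\<^esub> (x, id)"
        using that kD by (simp only: inv_base mult_base D.inv_closed D.m_closed)
      also have "\<dots> \<in> H"
        by (rule H.inv_op_closed2) (use that in \<open>auto simp: K_def permutes_id\<close>)
      finally show ?thesis by (simp add: K_def)
    qed
  qed
  show "perm_invariant G m K"
    unfolding perm_invariant_def
  proof (intro ballI)
    fix \<sigma> g assume "\<sigma> \<in> carrier (sym_lr m)" and g: "g \<in> carrier (dpower G m)"
    then have \<sigma>: "\<sigma> permutes {1..m}" by simp
    show "g \<in> K \<longleftrightarrow> permute_tuple m g \<sigma> \<in> K"
      unfolding K_def mem_Collect_eq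
      using W.normal_conj_mem_iff[OF H _ _ _ wreath_perm_conj_base[OF g \<sigma>]] g \<sigma>
      by (auto simp: permutes_id D.one_closed)
  qed
qed

lemma base_type_subgroup_of_base_elements:
  assumes base: "\<And>g \<sigma>. (g, \<sigma>) \<in> H \<Longrightarrow> \<sigma> = id"
  shows "H = base_type_subgroup m {k. (k, id) \<in> H}"
  using base by (force simp: base_type_subgroup_def)

section \<open>The subgroups given by a homomorphism\<close>

lemma coset_tuple_prod_eq_finprod:
  assumes N: "N \<lhd> G" "comm_group (G Mod N)" and g: "g \<in> carrier (dpower G m)"
  shows "N #> tuple_prod G m g = finprod (G Mod N) (\<lambda>i. N #> g i) {1..m}"
  using hom_tuple_prod_eq_finprod[OF N(2) normal.r_coset_hom_Mod[OF N(1)] g] .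

text \<open>
  The homomorphism underlying \<open>\<Xi>\<close>; it is multiplicative on \<open>G\<^sup>m\<close> because \<open>G/N\<close> is abelian.
\<close>

lemma coset_tuple_prod_hom:
  assumes N: "N \<lhd> G" "comm_group (G Mod N)"
  shows "(\<lambda>g. N #> tuple_prod G m g) \<in> hom (dpower G m) (G Mod N)"
proof (rule homI)
  interpret A: comm_group "G Mod N" by fact
  have cl: "N #> x \<in> carrier (G Mod N)" if "x \<in> carrier G" for x
    using that by (auto simp: carrier_FactGroup)
  show "N #> tuple_prod G m g \<in> carrier (G Mod N)" if "g \<in> carrier (dpower G m)" for g
    using that by (intro cl tuple_prod_closed)
  show "N #> tuple_prod G m (g \<otimes>\<^bsub>dpower G m\<^esub> h) =
      (N #> tuple_prod G m g) \<otimes>\<^bsub>G Mod N\<^esub> (N #> tuple_prod G m h)"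
    if gh: "g \<in> carrier (dpower G m)" "h \<in> carrier (dpower G m)" for g h
  proof -
    have c: "g i \<in> carrier G" "h i \<in> carrier G" if "i \<in> {1..m}" for i
      using gh that by (auto simp: PiE_iff)
    have "N #> tuple_prod G m (g \<otimes>\<^bsub>dpower G m\<^esub> h) =
        finprod (G Mod N) (\<lambda>i. N #> (g \<otimes>\<^bsub>dpower G m\<^esub> h) i) {1..m}"
      by (intro coset_tuple_prod_eq_finprod N monoid.m_closed[OF group.is_monoid] group_dpower gh)
    also have "\<dots> = finprod (G Mod N) (\<lambda>i. (N #> g i) \<otimes>\<^bsub>G Mod N\<^esub> (N #> h i)) {1..m}"
      using c hom_mult[OF normal.r_coset_hom_Mod[OF N(1)]]
      by (intro A.finprod_cong' refl) (auto intro!: A.m_closed cl simp del: mult_FactGroup)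
    also have "\<dots> = finprod (G Mod N) (\<lambda>i. N #> g i) {1..m} \<otimes>\<^bsub>G Mod N\<^esub>
        finprod (G Mod N) (\<lambda>i. N #> h i) {1..m}"
      using c by (intro A.finprod_multf) (auto intro!: cl)
    finally show ?thesis
      using gh by (simp only: coset_tuple_prod_eq_finprod[OF N])
  qed
qed

lemma coset_tuple_prod_permute:
  assumes N: "N \<lhd> G" "comm_group (G Mod N)"
    and g: "g \<in> carrier (dpower G m)" and \<sigma>: "\<sigma> permutes {1..m}"
  shows "N #> tuple_prod G m (permute_tuple m g \<sigma>) = N #> tuple_prod G m g"
proof -
  interpret A: comm_group "G Mod N" by fact
  have c: "N #> g i \<in> carrier (G Mod N)" if "i \<in> {1..m}" for i
    using g that by (auto simp: PiE_iff carrier_FactGroup)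
  have "N #> tuple_prod G m (permute_tuple m g \<sigma>) =
      finprod (G Mod N) (\<lambda>i. N #> permute_tuple m g \<sigma> i) {1..m}"
    by (intro coset_tuple_prod_eq_finprod N permute_tuple_closed g \<sigma>)
  also have "\<dots> = finprod (G Mod N) (\<lambda>i. N #> g (\<sigma> i)) {1..m}"
    using c permutes_in_image[OF \<sigma>]
    by (intro A.finprod_cong' refl) (auto simp: permute_tuple_def)
  also have "\<dots> = finprod (G Mod N) (\<lambda>i. N #> g i) (\<sigma> ` {1..m})"
    using c permutes_in_image[OF \<sigma>]
    by (intro A.finprod_reindex[symmetric]) (auto intro: permutes_inj_on[OF \<sigma>])
  also have "\<dots> = N #> tuple_prod G m g"
    unfolding permutes_image[OF \<sigma>] using coset_tuple_prod_eq_finprod[OF N g] by simp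
  finally show ?thesis .
qed

text \<open>
  The subgroup \<open>prod_in\<close> is the kernel of the coset map of ordered products, so that map is constant
  on its cosets and the element selected in the definition of \<open>\<Xi>\<close> is really unique.
\<close>

lemma Xi_coset:
  assumes N: "N \<lhd> G" "comm_group (G Mod N)" and g: "g \<in> carrier (dpower G m)"
  shows "Xi G m N (prod_in G m N #>\<^bsub>dpower G m\<^esub> g) = N #> tuple_prod G m g"
proof -
  interpret A: comm_group "G Mod N" by fact
  interpret p: group_hom "dpower G m" "G Mod N" "\<lambda>g. N #> tuple_prod G m g"
    by (rule group_hom.intro)
      (auto simp: group_hom_axioms_def coset_tuple_prod_hom[OF N] simp del: carrier_product_group)
  have sub: "subgroup N G" using N(1) by (rule normal_imp_subgroup)
  note [simp del] = p.hom_mult mult_product_group mult_FactGroup one_FactGroup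
    carrier_product_group one_product_group
  have const: "N #> tuple_prod G m (k \<otimes>\<^bsub>dpower G m\<^esub> g) = N #> tuple_prod G m g"
    if "k \<in> prod_in G m N" for k
  proof -
    have k: "k \<in> carrier (dpower G m)" "tuple_prod G m k \<in> N"
      using that by (auto simp: prod_in_def)
    have "N #> tuple_prod G m k = \<one>\<^bsub>G Mod N\<^esub>"
      unfolding one_FactGroup using k tuple_prod_closed[OF k(1)] sub coset_join2 by blast
    then show ?thesis using p.hom_mult[OF k(1) g] g p.hom_closed[OF g] by simp
  qed
  have one: "\<one>\<^bsub>dpower G m\<^esub> \<in> carrier (dpower G m)"
    using group.is_monoid[OF group_dpower] by (rule monoid.one_closed)
  have "N #> tuple_prod G m \<one>\<^bsub>dpower G m\<^esub> = N"
    using p.hom_one by (simp add: one_FactGroup)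
  then have "tuple_prod G m \<one>\<^bsub>dpower G m\<^esub> \<in> N"
    by (rule coset_join1) (use sub in \<open>auto intro: tuple_prod_closed[OF one]\<close>)
  then have "\<one>\<^bsub>dpower G m\<^esub> \<in> prod_in G m N"
    using one by (simp add: prod_in_def)
  then have "(\<lambda>g. N #> tuple_prod G m g) ` (prod_in G m N #>\<^bsub>dpower G m\<^esub> g) =
      {N #> tuple_prod G m g}"
    using const by (auto simp: r_coset_def image_iff)
  then show ?thesis by (simp add: Xi_def)
qed

lemma hom_type_subgroup_eq:
  assumes N: "N \<lhd> G" "comm_group (G Mod N)" and Q: "Q \<subseteq> {\<sigma>. \<sigma> permutes {1..m}}"
  shows "hom_type_subgroup G m N Q \<xi> =
    {x \<in> carrier (wreath_sym G m). snd x \<in> Q \<and> N #> tuple_prod G m (fst x) = \<xi> (snd x)}"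
  using Xi_coset[OF N] Q
  by (auto simp: hom_type_subgroup_def simp del: carrier_product_group)

text \<open>
  The coset of the ordered product ignores permutations, so the twist in the multiplication of the
  wreath product is invisible and the map extends from \<open>G\<^sup>m\<close> to the whole group.
\<close>

lemma wreath_coset_tuple_prod_hom:
  assumes N: "N \<lhd> G" "comm_group (G Mod N)"
  shows "(\<lambda>x. N #> tuple_prod G m (fst x)) \<in> hom (wreath_sym G m) (G Mod N)"
  using hom_mult[OF coset_tuple_prod_hom[OF N]] hom_in_carrier[OF coset_tuple_prod_hom[OF N]]
  by (intro homI)
    (auto simp: coset_tuple_prod_permute[OF N] simp del: mult_product_group carrier_product_group
      mult_FactGroup)

text \<open>
  The subgroup is where two homomorphisms agree: the coset of the ordered product, and \<open>\<xi>\<close> after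
  the projection to \<open>Q\<close>. Under conjugation the first is unchanged because its values commute, the
  second by the assumption on \<open>\<xi>\<close>.
\<close>

lemma hom_type_subgroup_normal:
  assumes N: "N \<lhd> G" "comm_group (G Mod N)"
    and Q: "Q \<lhd> sym_lr m" and \<xi>: "\<xi> \<in> hom ((sym_lr m) \<lparr> carrier := Q \<rparr>) (G Mod N)"
    and inv: "conj_invariant m Q \<xi>"
  shows "hom_type_subgroup G m N Q \<xi> \<lhd> wreath_sym G m"
proof -
  interpret A: comm_group "G Mod N" by fact
  interpret S: group "sym_lr m" by simp
  interpret W: group "wreath_sym G m" by simp
  interpret Q: normal Q "sym_lr m" by fact
  note [simp del] = carrier_wreath mult_wreath one_wreath mult_FactGroup one_FactGroup
    mult_sym_lr one_sym_lr carrier_sym_lr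
  define \<phi> where "\<phi> x = N #> tuple_prod G m (fst x)" for x :: "(nat \<Rightarrow> 'a) \<times> (nat \<Rightarrow> nat)"
  interpret \<phi>: group_hom "wreath_sym G m" "G Mod N" \<phi>
    by (rule group_hom.intro)
      (auto simp: group_hom_axioms_def wreath_coset_tuple_prod_hom[OF N] \<phi>_def[abs_def])
  interpret s: group_hom "wreath_sym G m" "sym_lr m" snd
    by (rule group_hom.intro) (auto simp: group_hom_axioms_def snd_hom_wreath)
  interpret \<xi>: group_hom "(sym_lr m) \<lparr> carrier := Q \<rparr>" "G Mod N" \<xi>
    by (rule group_hom.intro)
      (auto simp: group_hom_axioms_def \<xi> intro: Q.subgroup_is_group)
  define H where "H = {x \<in> carrier (wreath_sym G m). snd x \<in> Q \<and> \<phi> x = \<xi> (snd x)}"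
  have "hom_type_subgroup G m N Q \<xi> = H"
    unfolding H_def \<phi>_def using hom_type_subgroup_eq[OF N] Q.subset by (simp add: carrier_sym_lr)
  moreover have "H \<lhd> wreath_sym G m"
    unfolding W.normal_inv_iff
  proof (intro conjI ballI)
    show "subgroup H (wreath_sym G m)"
    proof (rule W.subgroupI)
      have "\<one>\<^bsub>wreath_sym G m\<^esub> \<in> H"
        using \<xi>.hom_one by (simp add: H_def)
      then show "H \<noteq> {}" by blast
      show "x \<otimes>\<^bsub>wreath_sym G m\<^esub> y \<in> H" if "x \<in> H" "y \<in> H" for x y
        using that \<xi>.hom_mult[of "snd x" "snd y"] by (auto simp: H_def)
      show "inv\<^bsub>wreath_sym G m\<^esub> x \<in> H" if "x \<in> H" for x
        using that \<xi>.hom_inv[of "snd x"] S.m_inv_consistent[OF Q.subgroup_axioms]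
        by (auto simp: H_def)
    qed (auto simp: H_def)
    fix x h assume x: "x \<in> carrier (wreath_sym G m)" and h: "h \<in> H"
    have hc: "h \<in> carrier (wreath_sym G m)" "snd h \<in> Q" "\<phi> h = \<xi> (snd h)"
      using h by (auto simp: H_def)
    let ?y = "x \<otimes>\<^bsub>wreath_sym G m\<^esub> h \<otimes>\<^bsub>wreath_sym G m\<^esub> inv\<^bsub>wreath_sym G m\<^esub> x"
    have "\<phi> ?y = \<phi> h"
      using x hc(1) by (simp add: A.m_comm[of "\<phi> x"] A.m_assoc)
    moreover have "\<xi> (snd x \<otimes>\<^bsub>sym_lr m\<^esub> snd h \<otimes>\<^bsub>sym_lr m\<^esub> inv\<^bsub>sym_lr m\<^esub> snd x) = \<xi> (snd h)"
      using inv hc(2) s.hom_closed[OF x] S.inv_closed[of "snd x"] S.inv_inv[of "snd x"]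
      unfolding conj_invariant_def by metis
    ultimately show "?y \<in> H"
      using x hc Q.inv_op_closed2[of "snd x" "snd h"] by (simp add: H_def)
  qed
  ultimately show ?thesis by simp
qed

section \<open>Normal subgroups outside the base group\<close>

text \<open>
  If a homomorphism kills \<open>(g, \<sigma>)\<close> with \<open>\<sigma> i = k \<noteq> i\<close>, it cannot distinguish an entry \<open>x\<close> at
  position \<open>k\<close> from the conjugate entry \<open>g\<^sub>i x g\<^sub>i\<^sup>-\<^sup>1\<close> at position \<open>i\<close>. The transposition of
  \<open>k\<close> with any \<open>l\<close> other than \<open>i\<close> moves the first entry and fixes the second, so \<open>x\<close> at \<open>l\<close> has the same
  image as \<open>x\<close> at \<open>k\<close>. Position \<open>i\<close> itself is reached from such an \<open>l\<close> by one more
  transposition, which needs a third position.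
\<close>

lemma single_tuple_hom_independent:
  assumes A: "group A" and p: "p \<in> hom (wreath_sym G m) A" and m: "3 \<le> m"
    and g: "g \<in> carrier (dpower G m)" and \<sigma>: "\<sigma> permutes {1..m}" "\<sigma> \<noteq> id"
    and triv: "p (g, \<sigma>) = \<one>\<^bsub>A\<^esub>"
    and jl: "j \<in> {1..m}" "l \<in> {1..m}" and x: "x \<in> carrier G"
  shows "p (single_tuple m j x, id) = p (single_tuple m l x, id)"
proof -
  interpret A: group A by fact
  interpret D: group "dpower G m" by simp
  interpret p: group_hom "wreath_sym G m" A p
    by (rule group_hom.intro) (auto simp: group_hom_axioms_def A p)
  note [simp del] = p.hom_mult p.hom_one one_product_group mult_product_group carrier_product_group
  define c where "c h = p (h, id)" for h
  define u where "u \<tau> = p (\<one>\<^bsub>dpower G m\<^esub>, \<tau>)" for \<tau>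
  have c_closed [simp]: "c h \<in> carrier A" if "h \<in> carrier (dpower G m)" for h
    using that by (auto simp: c_def permutes_id intro!: p.hom_closed)
  have u_closed [simp]: "u \<tau> \<in> carrier A" if "\<tau> permutes {1..m}" for \<tau>
    using that by (auto simp: u_def intro!: p.hom_closed)
  have c_mult: "c (h \<otimes>\<^bsub>dpower G m\<^esub> h') = c h \<otimes>\<^bsub>A\<^esub> c h'"
    if "h \<in> carrier (dpower G m)" "h' \<in> carrier (dpower G m)" for h h'
    using that p.hom_mult[of "(h, id)" "(h', id)"] by (simp add: c_def permutes_id)
  have u_c: "u \<tau> \<otimes>\<^bsub>A\<^esub> c h = c (permute_tuple m h \<tau>) \<otimes>\<^bsub>A\<^esub> u \<tau>"
    if h: "h \<in> carrier (dpower G m)" and \<tau>: "\<tau> permutes {1..m}" for h \<tau>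
    using p.hom_mult[of "(\<one>\<^bsub>dpower G m\<^esub>, \<tau>)" "(h, id)"]
      p.hom_mult[of "(permute_tuple m h \<tau>, id)" "(\<one>\<^bsub>dpower G m\<^esub>, \<tau>)"] h \<tau>
      wreath_perm_conj_base[OF h \<tau>]
    by (simp add: c_def u_def permutes_id del: mult_wreath)
  \<comment> \<open>equality of images is stable under permuting entries, since \<open>u \<tau>\<close> realises this as conjugation\<close>
  have c_permute: "c (permute_tuple m h \<tau>) = c (permute_tuple m h' \<tau>)"
    if "c h = c h'" "h \<in> carrier (dpower G m)" "h' \<in> carrier (dpower G m)" "\<tau> permutes {1..m}"
    for h h' \<tau>
    using u_c[OF that(2,4)] u_c[OF that(3,4)] that
    by (metis A.r_cancel c_closed u_closed permute_tuple_closed)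
  have gu: "c g \<otimes>\<^bsub>A\<^esub> u \<sigma> = \<one>\<^bsub>A\<^esub>"
    using p.hom_mult[of "(g, id)" "(\<one>\<^bsub>dpower G m\<^esub>, \<sigma>)"] triv g \<sigma>
      wreath_eq_base_times_perm[OF g \<sigma>(1)]
    by (simp add: c_def u_def permutes_id del: mult_wreath)
  then have u: "u \<sigma> = inv\<^bsub>A\<^esub> c g"
    using A.inv_equality[of "c g" "u \<sigma>"] A.inv_inv g \<sigma> c_closed u_closed by metis
  \<comment> \<open>\<open>(g, \<sigma>)\<close> is killed, so permuting by \<open>\<sigma>\<close> is undone by conjugation with \<open>c g\<close>\<close>
  have c_conj: "c h \<otimes>\<^bsub>A\<^esub> c g = c g \<otimes>\<^bsub>A\<^esub> c (permute_tuple m h \<sigma>)"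
    if h: "h \<in> carrier (dpower G m)" for h
  proof -
    have "c (permute_tuple m h \<sigma>) = inv\<^bsub>A\<^esub> c g \<otimes>\<^bsub>A\<^esub> (c h \<otimes>\<^bsub>A\<^esub> c g)"
      using u_c[OF h \<sigma>(1)] h g \<sigma>(1) unfolding u
      by (simp add: A.inv_solve_left' A.inv_solve_right A.m_assoc)
    then show ?thesis using h g by (simp add: A.m_assoc[symmetric])
  qed
  obtain i where i: "\<sigma> i \<noteq> i" using \<sigma>(2) by (auto simp: fun_eq_iff)
  then have im: "i \<in> {1..m}" using \<sigma>(1) by (meson permutes_not_in)
  define k where "k = \<sigma> i"
  have k: "k \<in> {1..m}" "k \<noteq> i"
    using i im permutes_in_image[OF \<sigma>(1)] by (auto simp: k_def)
  have single: "c (single_tuple m l x) = c (single_tuple m k x)" if l: "l \<in> {1..m}" for l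
  proof -
    let ?y = "g i \<otimes> x \<otimes> inv (g i)"
    have gi: "g i \<in> carrier G" using g im by (auto simp: PiE_iff carrier_product_group)
    have y: "?y \<in> carrier G" using gi x by simp
    have "c (single_tuple m k x) \<otimes>\<^bsub>A\<^esub> c g = c g \<otimes>\<^bsub>A\<^esub> c (single_tuple m i x)"
      using c_conj[of "single_tuple m k x"] permute_single_tuple[OF \<sigma>(1), of i x] x
      by (simp add: k_def)
    also have "\<dots> = c (single_tuple m i ?y) \<otimes>\<^bsub>A\<^esub> c g"
      using conj_single_tuple[OF g x im] c_mult g x y
      by (metis single_tuple_closed)
    finally have ki: "c (single_tuple m k x) = c (single_tuple m i ?y)"
      using x y g by (simp add: A.r_cancel)
    have other: "c (single_tuple m l x) = c (single_tuple m k x)"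
      if l: "l \<in> {1..m}" "l \<noteq> i" "l \<noteq> k" for l
    proof -
      let ?t = "Transposition.transpose k l"
      have t: "?t permutes {1..m}" using k(1) l(1) by (rule permutes_swap_id)
      have "permute_tuple m (single_tuple m k x) ?t = single_tuple m l x"
        using permute_single_tuple[OF t, of l x] by simp
      moreover have "permute_tuple m (single_tuple m i ?y) ?t = single_tuple m i ?y"
        using permute_single_tuple[OF t, of i ?y] k l by simp
      ultimately show ?thesis
        using c_permute[OF ki _ _ t] x y ki by simp
    qed
    obtain l' where l': "l' \<in> {1..m}" "l' \<noteq> i" "l' \<noteq> k"
      using exists_fresh_index[of "{i, k}" m] m k by auto
    let ?t = "Transposition.transpose i l'"
    have t: "?t permutes {1..m}" using im l'(1) by (rule permutes_swap_id)
    have "permute_tuple m (single_tuple m l' x) ?t = single_tuple m i x"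
      using permute_single_tuple[OF t, of i x] by simp
    moreover have "permute_tuple m (single_tuple m k x) ?t = single_tuple m k x"
      using permute_single_tuple[OF t, of k x] k l' by simp
    ultimately have "c (single_tuple m i x) = c (single_tuple m k x)"
      using c_permute[OF other[OF l'] _ _ t] x by simp
    then show ?thesis using other[OF l] by (cases "l = i"; cases "l = k") auto
  qed
  then show ?thesis using jl by (simp add: c_def)
qed

text \<open>
  Since the position of an entry does not matter, \<open>x\<close> and \<open>y\<close> may be placed at positions \<open>1\<close> and
  \<open>2\<close>, where they commute; and the image of a tuple is the product of the images of its entries, all
  computed at position \<open>1\<close>.
\<close>

lemma hom_base_factors_through_tuple_prod:
  assumes A: "group A" and p: "p \<in> hom (wreath_sym G m) A" and m: "3 \<le> m"
    and g: "g \<in> carrier (dpower G m)" and \<sigma>: "\<sigma> permutes {1..m}" "\<sigma> \<noteq> id"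
    and triv: "p (g, \<sigma>) = \<one>\<^bsub>A\<^esub>"
  defines "\<delta> \<equiv> \<lambda>x. p (single_tuple m 1 x, id)"
  shows "\<delta> \<in> hom G A"
    and "\<And>x y. \<lbrakk>x \<in> carrier G; y \<in> carrier G\<rbrakk> \<Longrightarrow> \<delta> x \<otimes>\<^bsub>A\<^esub> \<delta> y = \<delta> y \<otimes>\<^bsub>A\<^esub> \<delta> x"
    and "\<And>h. h \<in> carrier (dpower G m) \<Longrightarrow> p (h, id) = \<delta> (tuple_prod G m h)"
proof -
  interpret D: group "dpower G m" by simp
  note [simp del] = one_product_group mult_product_group carrier_product_group
  define c where "c h = p (h, id)" for h
  have "p \<circ> (\<lambda>k. (k, id)) \<in> hom (dpower G m) A"
    by (rule Group.hom_compose[OF hom_base_wreath p])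
  then have c: "c \<in> hom (dpower G m) A" by (simp add: c_def[abs_def] o_def)
  have indep: "c (single_tuple m j x) = \<delta> x" if "j \<in> {1..m}" "x \<in> carrier G" for j x
    using single_tuple_hom_independent[OF A p m g \<sigma> triv that(1) _ that(2), of 1] m
    by (simp add: c_def \<delta>_def)
  show hom: "\<delta> \<in> hom G A"
  proof (rule homI)
    show "\<delta> x \<in> carrier A" if "x \<in> carrier G" for x
      using hom_in_carrier[OF c single_tuple_closed[OF that]] by (simp add: c_def \<delta>_def)
    show "\<delta> (x \<otimes> y) = \<delta> x \<otimes>\<^bsub>A\<^esub> \<delta> y" if "x \<in> carrier G" "y \<in> carrier G" for x y
      using hom_mult[OF c single_tuple_closed[OF that(1)] single_tuple_closed[OF that(2)]]
        single_tuple_mult[OF that]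
      by (simp add: c_def \<delta>_def)
  qed
  show "\<delta> x \<otimes>\<^bsub>A\<^esub> \<delta> y = \<delta> y \<otimes>\<^bsub>A\<^esub> \<delta> x" if xy: "x \<in> carrier G" "y \<in> carrier G" for x y
  proof -
    have "c (single_tuple m 1 x) \<otimes>\<^bsub>A\<^esub> c (single_tuple m 2 y) =
        c (single_tuple m 2 y) \<otimes>\<^bsub>A\<^esub> c (single_tuple m 1 x)"
      using single_tuple_commute[OF xy, of 1 2 m]
        hom_mult[OF c single_tuple_closed[OF xy(1), of m 1] single_tuple_closed[OF xy(2), of m 2]]
        hom_mult[OF c single_tuple_closed[OF xy(2), of m 2] single_tuple_closed[OF xy(1), of m 1]]
      by simp
    then show ?thesis using indep xy m by simp
  qed
  show "p (h, id) = \<delta> (tuple_prod G m h)" if h: "h \<in> carrier (dpower G m)" for h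
  proof -
    interpret \<delta>: group_hom G A \<delta>
      by (rule group_hom.intro) (auto simp: group_hom_axioms_def A hom)
    have hc: "h j \<in> carrier G" if "j \<in> {1..m}" for j
      using h that by (auto simp: PiE_iff carrier_product_group)
    have "foldr (\<otimes>) (map h xs) \<one> \<in> carrier G \<and>
      foldr (\<otimes>\<^bsub>A\<^esub>) (map (\<lambda>j. c (single_tuple m j (h j))) xs) \<one>\<^bsub>A\<^esub> =
        \<delta> (foldr (\<otimes>) (map h xs) \<one>)" if "set xs \<subseteq> {1..m}" for xs
      using that by (induction xs) (auto simp: hc indep)
    from this[of "[1..<Suc m]"] show ?thesis
      using hom_eq_foldr_single_tuple[OF A c h]
      by (simp add: tuple_prod_def c_def atLeastLessThanSuc_atLeastAtMost del: upt_Suc)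
  qed
qed

text \<open>
  The quotient by \<open>H\<close> restricts to the base group as \<open>\<delta>\<close> of the ordered product. Two elements of
  the wreath product with the same permutation part therefore agree modulo \<open>H\<close> exactly if their
  ordered products agree modulo \<open>N = ker \<delta>\<close>; this one equivalence makes \<open>\<xi>\<close> well defined and
  recovers \<open>H\<close> from it. The values of \<open>\<xi>\<close> inherit multiplicativity and conjugation invariance from the
  homomorphism \<open>\<phi>\<close> on the wreath product.
\<close>

lemma normal_wreath_not_base_is_hom_type:
  assumes H: "H \<lhd> wreath_sym G m" and m: "3 \<le> m"
    and g0: "(g0, \<sigma>0) \<in> H" "\<sigma>0 \<noteq> id"
  obtains N Q \<xi> where "N \<lhd> G" "comm_group (G Mod N)" "Q \<lhd> sym_lr m" "Q \<noteq> {\<one>\<^bsub>sym_lr m\<^esub>}"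
    "\<xi> \<in> hom ((sym_lr m) \<lparr> carrier := Q \<rparr>) (G Mod N)" "conj_invariant m Q \<xi>"
    "H = hom_type_subgroup G m N Q \<xi>"
proof -
  let ?W = "wreath_sym G m"
  interpret W: group ?W by simp
  interpret D: group "dpower G m" by simp
  interpret S: group "sym_lr m" by simp
  interpret H: normal H ?W by fact
  have H_carrier: "x \<in> carrier ?W" if "x \<in> H" for x using that H.subset by blast
  define A where "A = ?W Mod H"
  define p where "p x = H #>\<^bsub>?W\<^esub> x" for x
  have A: "group A" unfolding A_def by (rule H.factorgroup_is_group)
  interpret A: group A by fact
  have p: "p \<in> hom ?W A"
    unfolding A_def p_def[abs_def] by (rule H.r_coset_hom_Mod)
  have mem_H: "x \<in> H \<longleftrightarrow> p x = \<one>\<^bsub>A\<^esub>" if "x \<in> carrier ?W" for x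
    using W.coset_join1[OF _ that H.subgroup_axioms] W.coset_join2[OF that H.subgroup_axioms]
    by (auto simp: A_def p_def)
  define \<delta> where "\<delta> x = p (single_tuple m 1 x, id)" for x
  have g0W: "(g0, \<sigma>0) \<in> carrier ?W" using g0(1) by (rule H_carrier)
  then have g0': "g0 \<in> carrier (dpower G m)" "\<sigma>0 permutes {1..m}" "p (g0, \<sigma>0) = \<one>\<^bsub>A\<^esub>"
    using mem_H[OF g0W] g0(1) by simp_all
  note factor = hom_base_factors_through_tuple_prod[OF A p m g0'(1,2) g0(2) g0'(3)]
  have \<delta>: "\<delta> \<in> hom G A"
    unfolding \<delta>_def[abs_def] by (rule factor(1))
  have \<delta>_comm: "\<delta> x \<otimes>\<^bsub>A\<^esub> \<delta> y = \<delta> y \<otimes>\<^bsub>A\<^esub> \<delta> x" if "x \<in> carrier G" "y \<in> carrier G" for x y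
    unfolding \<delta>_def using that by (rule factor(2))
  have p_base: "p (h, id) = \<delta> (tuple_prod G m h)" if "h \<in> carrier (dpower G m)" for h
    unfolding \<delta>_def using that by (rule factor(3))
  define N where "N = kernel G A \<delta>"
  interpret \<delta>: group_hom G A \<delta>
    by (rule group_hom.intro) (auto simp: group_hom_axioms_def A \<delta>)
  have N: "N \<lhd> G" "comm_group (G Mod N)"
    unfolding N_def using \<delta>.normal_kernel comm_group_Mod_kernel[OF A \<delta> \<delta>_comm] by auto
  interpret B: comm_group "G Mod N" by (rule N(2))
  define \<phi> where "\<phi> x = N #> tuple_prod G m (fst x)" for x :: "(nat \<Rightarrow> 'a) \<times> (nat \<Rightarrow> nat)"
  have \<phi>: "\<phi> \<in> hom ?W (G Mod N)"
    unfolding \<phi>_def[abs_def] by (rule wreath_coset_tuple_prod_hom[OF N])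
  interpret \<phi>: group_hom ?W "G Mod N" \<phi>
    by (rule group_hom.intro) (auto simp: group_hom_axioms_def \<phi>)
  interpret s: group_hom ?W "sym_lr m" snd
    by (rule group_hom.intro) (auto simp: group_hom_axioms_def snd_hom_wreath)
  note [simp del] = mult_wreath one_wreath mult_FactGroup one_FactGroup
    mult_sym_lr one_sym_lr one_product_group mult_product_group carrier_product_group
  have \<phi>_eq_iff: "\<phi> x = \<phi> y \<longleftrightarrow> p x = p y"
    if xyW: "x \<in> carrier ?W" "y \<in> carrier ?W" "snd x = snd y" for x y
  proof -
    obtain g h q where xy: "x = (g, q)" "y = (h, q)" using xyW(3) by (cases x; cases y) auto
    have gh: "g \<in> carrier (dpower G m)" "h \<in> carrier (dpower G m)" and q: "q permutes {1..m}"
      using xyW xy by auto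
    have p_split: "p (k, q) = p (k, id) \<otimes>\<^bsub>A\<^esub> p (\<one>\<^bsub>dpower G m\<^esub>, q)"
      if k: "k \<in> carrier (dpower G m)" for k
      using hom_mult[OF p, of "(k, id)" "(\<one>\<^bsub>dpower G m\<^esub>, q)"]
        wreath_eq_base_times_perm[OF k q] k q by (simp add: permutes_id)
    have pc: "p z \<in> carrier A" if "z \<in> carrier ?W" for z using hom_in_carrier[OF p that] .
    have "p x = p y \<longleftrightarrow> p (g, id) = p (h, id)"
      using gh q unfolding xy p_split[OF gh(1)] p_split[OF gh(2)]
      by (intro A.right_cancel pc) (auto simp: permutes_id)
    also have "\<dots> \<longleftrightarrow> \<phi> x = \<phi> y"
      using p_base[OF gh(1)] p_base[OF gh(2)]
        kernel_coset_eq_iff[OF A \<delta> tuple_prod_closed[OF gh(1)] tuple_prod_closed[OF gh(2)]]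
      by (simp add: \<phi>_def xy N_def)
    finally show ?thesis by simp
  qed
  define Q where "Q = snd ` H"
  have Q_surj: "snd ` carrier ?W = carrier (sym_lr m)"
    using D.one_closed by (auto simp: image_iff)
  have Q: "Q \<lhd> sym_lr m"
    unfolding Q_def by (rule H.surj_hom_normal_subgroup[OF s.group_hom_axioms Q_surj])
  have Q_ne: "Q \<noteq> {\<one>\<^bsub>sym_lr m\<^esub>}"
    using g0 by (force simp: Q_def one_sym_lr)
  define \<xi> where "\<xi> q = \<phi> (SOME x. x \<in> H \<and> snd x = q)" for q
  have \<xi>_snd: "\<xi> (snd x) = \<phi> x" if x: "x \<in> H" for x
  proof -
    define y where "y = (SOME y. y \<in> H \<and> snd y = snd x)"
    have y: "y \<in> H" "snd y = snd x"
      unfolding y_def using someI[of "\<lambda>y. y \<in> H \<and> snd y = snd x" x] x by auto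
    then have "\<phi> y = \<phi> x"
      using \<phi>_eq_iff[OF H_carrier[OF y(1)] H_carrier[OF x] y(2)] x y(1)
        mem_H[OF H_carrier[OF y(1)]] mem_H[OF H_carrier[OF x]] by simp
    then show ?thesis by (simp add: \<xi>_def y_def)
  qed
  have \<xi>: "\<xi> \<in> hom ((sym_lr m) \<lparr> carrier := Q \<rparr>) (G Mod N)"
  proof (rule homI)
    show "\<xi> q \<in> carrier (G Mod N)" if "q \<in> carrier ((sym_lr m) \<lparr> carrier := Q \<rparr>)" for q
      using that \<xi>_snd H_carrier by (auto simp: Q_def simp del: carrier_wreath)
    show "\<xi> (q \<otimes>\<^bsub>(sym_lr m) \<lparr> carrier := Q \<rparr>\<^esub> r) = \<xi> q \<otimes>\<^bsub>G Mod N\<^esub> \<xi> r"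
      if qr: "q \<in> carrier ((sym_lr m) \<lparr> carrier := Q \<rparr>)" "r \<in> carrier ((sym_lr m) \<lparr> carrier := Q \<rparr>)"
      for q r
    proof -
      obtain x y where xy: "x \<in> H" "y \<in> H" "q = snd x" "r = snd y"
        using qr by (auto simp: Q_def)
      have "\<xi> (snd (x \<otimes>\<^bsub>?W\<^esub> y)) = \<phi> (x \<otimes>\<^bsub>?W\<^esub> y)"
        using xy by (intro \<xi>_snd subgroup.m_closed[OF H.subgroup_axioms])
      then show ?thesis
        using xy H_carrier \<xi>_snd by (simp del: carrier_wreath)
    qed
  qed
  have conj: "conj_invariant m Q \<xi>"
    unfolding conj_invariant_def
  proof (intro ballI)
    fix \<tau> q assume \<tau>: "\<tau> \<in> carrier (sym_lr m)" and "q \<in> Q"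
    then obtain x where x: "x \<in> H" "q = snd x" by (auto simp: Q_def)
    define t where "t = (\<one>\<^bsub>dpower G m\<^esub>, \<tau>)"
    have t: "t \<in> carrier ?W" "snd t = \<tau>" using \<tau> by (auto simp: t_def)
    let ?z = "inv\<^bsub>?W\<^esub> t \<otimes>\<^bsub>?W\<^esub> x \<otimes>\<^bsub>?W\<^esub> t"
    have z: "?z \<in> H" using t x by (intro H.inv_op_closed1)
    have xW: "x \<in> carrier ?W" using x H_carrier by blast
    have "\<phi> ?z = \<phi> x"
      using t(1) xW by (simp add: B.m_comm[of _ "\<phi> x"] B.m_assoc del: carrier_wreath)
    moreover have "snd ?z = inv\<^bsub>sym_lr m\<^esub> \<tau> \<otimes>\<^bsub>sym_lr m\<^esub> q \<otimes>\<^bsub>sym_lr m\<^esub> \<tau>"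
      using t xW x by (simp del: carrier_wreath)
    ultimately show "\<xi> (inv\<^bsub>sym_lr m\<^esub> \<tau> \<otimes>\<^bsub>sym_lr m\<^esub> q \<otimes>\<^bsub>sym_lr m\<^esub> \<tau>) = \<xi> q"
      using \<xi>_snd[OF z] \<xi>_snd[OF x(1)] x(2) by simp
  qed
  have "H = hom_type_subgroup G m N Q \<xi>"
  proof -
    have "x \<in> H \<longleftrightarrow> snd x \<in> Q \<and> \<phi> x = \<xi> (snd x)" if x: "x \<in> carrier ?W" for x
    proof
      show "x \<in> H" if "snd x \<in> Q \<and> \<phi> x = \<xi> (snd x)"
      proof -
        obtain y where y: "y \<in> H" "snd x = snd y" using \<open>snd x \<in> Q \<and> \<phi> x = \<xi> (snd x)\<close> by (auto simp: Q_def)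
        then have "\<phi> x = \<phi> y" using that \<xi>_snd by simp
        then show ?thesis
          using \<phi>_eq_iff[OF x H_carrier[OF y(1)] y(2)] mem_H[OF x] mem_H[OF H_carrier[OF y(1)]] y(1)
          by simp
      qed
    qed (use \<xi>_snd in \<open>auto simp: Q_def\<close>)
    moreover have "Q \<subseteq> {\<sigma>. \<sigma> permutes {1..m}}"
      using H_carrier by (auto simp: Q_def)
    ultimately show ?thesis
      using hom_type_subgroup_eq[OF N, of Q m \<xi>] H_carrier unfolding \<phi>_def by blast
  qed
  then show thesis using that N Q Q_ne \<xi> conj by blast
qed

end

section \<open>Homomorphisms from normal subgroups of large symmetric groups\<close>

lemma conj_transpose:
  assumes "bij \<sigma>"
  shows "\<sigma> \<circ> Transposition.transpose a b \<circ> inv' \<sigma> = Transposition.transpose (\<sigma> a) (\<sigma> b)"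
proof -
  have "Transposition.transpose (\<sigma> a) (\<sigma> b) \<circ> \<sigma> = \<sigma> \<circ> Transposition.transpose a b"
    using transpose_comp_eq[OF assms, of "\<sigma> a" "\<sigma> b"] assms
    by (simp add: bij_is_inj)
  then have "\<sigma> \<circ> Transposition.transpose a b \<circ> inv' \<sigma> =
      Transposition.transpose (\<sigma> a) (\<sigma> b) \<circ> (\<sigma> \<circ> inv' \<sigma>)"
    by (simp add: o_assoc)
  then show ?thesis using assms by (simp add: surj_iff[THEN iffD1] bij_is_surj)
qed

lemma conj_transpose_comp_transpose:
  assumes "bij \<sigma>"
  shows "\<sigma> \<circ> (Transposition.transpose a b \<circ> Transposition.transpose c d) \<circ> inv' \<sigma> =
    Transposition.transpose (\<sigma> a) (\<sigma> b) \<circ> Transposition.transpose (\<sigma> c) (\<sigma> d)"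
proof -
  have "inv' \<sigma> \<circ> \<sigma> = id" using assms by (simp add: bij_is_inj)
  then have "\<sigma> \<circ> (Transposition.transpose a b \<circ> Transposition.transpose c d) \<circ> inv' \<sigma> =
    (\<sigma> \<circ> Transposition.transpose a b \<circ> inv' \<sigma>) \<circ> (\<sigma> \<circ> Transposition.transpose c d \<circ> inv' \<sigma>)"
    by (metis comp_assoc comp_id)
  then show ?thesis by (simp add: conj_transpose[OF assms])
qed

definition cycle3 :: "nat \<Rightarrow> nat \<Rightarrow> nat \<Rightarrow> nat \<Rightarrow> nat"
  where "cycle3 a b c = Transposition.transpose a b \<circ> Transposition.transpose b c"

lemma conj_cycle3:
  assumes "bij \<sigma>"
  shows "\<sigma> \<circ> cycle3 a b c \<circ> inv' \<sigma> = cycle3 (\<sigma> a) (\<sigma> b) (\<sigma> c)"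
  unfolding cycle3_def by (rule conj_transpose_comp_transpose[OF assms])

lemma transpose_comp_transpose:
  defines "t \<equiv> Transposition.transpose"
  shows "t a b \<circ> t c d = t (t a b c) (t a b d) \<circ> t a b"
proof -
  have "t (t a b c) (t a b d) \<circ> t a b = (t a b \<circ> t c d \<circ> inv' (t a b)) \<circ> t a b"
    unfolding t_def by (simp only: conj_transpose[OF bij_transpose])
  also have "\<dots> = t a b \<circ> t c d"
    by (simp add: t_def comp_assoc)
  finally show ?thesis by simp
qed

lemma cycle3_rotate:
  assumes "distinct [a, b, c]"
  shows "cycle3 a b c = cycle3 c a b"
  using transpose_comp_transpose[of a b b c] assms
  by (simp add: cycle3_def transpose_commute[of c a])

lemma inv_cycle3: "inv' (cycle3 a b c) = cycle3 c b a"
  by (simp add: cycle3_def o_inv_distrib transpose_commute)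

text \<open>
  Commutativity of \<open>A\<close> makes \<open>\<xi>\<close> multiplicative for both orders of composition, so the calculations
  can use plain function composition.
\<close>

locale sym_normal_hom = A: comm_group A + normal Q "sym_lr m"
  for m :: nat and Q :: "(nat \<Rightarrow> nat) set" and A :: "('c, 'd) monoid_scheme" +
  fixes \<xi> :: "(nat \<Rightarrow> nat) \<Rightarrow> 'c"
  assumes \<xi>: "\<xi> \<in> hom ((sym_lr m) \<lparr> carrier := Q \<rparr>) A"
begin

lemma Q_permutes: "q \<in> Q \<Longrightarrow> q permutes {1..m}"
  using subset by auto

lemma Q_comp: "p \<in> Q \<Longrightarrow> q \<in> Q \<Longrightarrow> p \<circ> q \<in> Q"
  using subgroup.m_closed[OF subgroup_axioms, of q p] by simp

lemma Q_inv: "q \<in> Q \<Longrightarrow> inv' q \<in> Q"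
  using m_inv_closed[of q] inv_sym_lr[OF Q_permutes] by simp

lemma Q_conj: "\<sigma> permutes {1..m} \<Longrightarrow> q \<in> Q \<Longrightarrow> \<sigma> \<circ> q \<circ> inv' \<sigma> \<in> Q"
  using inv_op_closed1[of \<sigma> q] by (simp add: inv_sym_lr o_assoc)

lemma \<xi>_closed [simp]: "q \<in> Q \<Longrightarrow> \<xi> q \<in> carrier A"
  using hom_in_carrier[OF \<xi>] by simp

lemma \<xi>_comp: "p \<in> Q \<Longrightarrow> q \<in> Q \<Longrightarrow> \<xi> (p \<circ> q) = \<xi> p \<otimes>\<^bsub>A\<^esub> \<xi> q"
  using hom_mult[OF \<xi>, of q p] by (simp add: A.m_comm)

lemma \<xi>_id: "\<xi> id = \<one>\<^bsub>A\<^esub>"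
proof -
  have "id \<in> Q" using subgroup.one_closed[OF subgroup_axioms] by simp
  then show ?thesis using \<xi>_comp[of id id] A.r_cancel_one'[of "\<xi> id" "\<xi> id"] by simp
qed

lemma cycle3_conj_mem:
  assumes "cycle3 a b c \<in> Q" "u \<in> {1..m}" "v \<in> {1..m}"
  defines "t \<equiv> Transposition.transpose u v"
  shows "cycle3 (t a) (t b) (t c) \<in> Q"
  using Q_conj[OF permutes_swap_id[OF assms(2,3)] assms(1)] conj_cycle3[of t a b c]
  by (simp add: t_def)

end

locale large_sym_normal_hom = sym_normal_hom +
  assumes m_ge_5: "5 \<le> m"
begin

text \<open>
  With two further points \<open>d\<close> and \<open>e\<close>, the cycle is the commutator of \<open>(a b d)\<close> and \<open>(a c e)\<close>. Both are
  conjugate to it, hence lie in \<open>Q\<close>, and \<open>\<xi>\<close> has commutative values.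
\<close>

lemma \<xi>_cycle3:
  assumes Q: "cycle3 a b c \<in> Q" and abc: "a \<in> {1..m}" "b \<in> {1..m}" "c \<in> {1..m}" "distinct [a, b, c]"
  shows "\<xi> (cycle3 a b c) = \<one>\<^bsub>A\<^esub>"
proof -
  obtain d where d: "d \<in> {1..m}" "d \<notin> {a, b, c}"
    using exists_fresh_index[of "{a, b, c}" m] m_ge_5 abc by auto
  obtain e where e: "e \<in> {1..m}" "e \<notin> {a, b, c, d}"
    using exists_fresh_index[of "{a, b, c, d}" m] m_ge_5 abc d by auto
  have x: "cycle3 a b d \<in> Q"
    using cycle3_conj_mem[OF Q abc(3) d(1)] abc(4) d(2) by (auto simp: transpose_def)
  have y0: "cycle3 a b e \<in> Q"
    using cycle3_conj_mem[OF Q abc(3) e(1)] abc(4) e(2) by (auto simp: transpose_def)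
  have y: "cycle3 a c e \<in> Q"
    using cycle3_conj_mem[OF y0 abc(2,3)] abc(4) e(2) by (auto simp: transpose_def)
  have x': "cycle3 d b a \<in> Q" and y': "cycle3 e c a \<in> Q"
    using Q_inv[OF x] Q_inv[OF y] by (simp_all add: inv_cycle3)
  have "cycle3 a b d \<circ> cycle3 d b a = id" "cycle3 a c e \<circ> cycle3 e c a = id"
    by (auto simp: cycle3_def fun_eq_iff transpose_commute)
  then have one: "\<xi> (cycle3 a b d) \<otimes>\<^bsub>A\<^esub> \<xi> (cycle3 d b a) = \<one>\<^bsub>A\<^esub>"
      "\<xi> (cycle3 a c e) \<otimes>\<^bsub>A\<^esub> \<xi> (cycle3 e c a) = \<one>\<^bsub>A\<^esub>"
    using \<xi>_comp[OF x x'] \<xi>_comp[OF y y'] \<xi>_id by auto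
  have commutator: "cycle3 a b c = (cycle3 a b d \<circ> cycle3 a c e) \<circ> (cycle3 d b a \<circ> cycle3 e c a)"
  proof -
    have "cycle3 a c e \<circ> cycle3 d b a \<circ> inv' (cycle3 a c e) = cycle3 d b c"
      using abc(4) d(2) e(2) by (subst conj_cycle3) (auto simp: cycle3_def transpose_def bij_comp)
    moreover have "cycle3 a b d \<circ> cycle3 d b c = cycle3 a b c"
      by (auto simp: cycle3_def fun_eq_iff transpose_commute)
    ultimately show ?thesis
      unfolding inv_cycle3 by (metis comp_assoc)
  qed
  have "\<xi> (cycle3 a b c) = (\<xi> (cycle3 a b d) \<otimes>\<^bsub>A\<^esub> \<xi> (cycle3 a c e)) \<otimes>\<^bsub>A\<^esub>
      (\<xi> (cycle3 d b a) \<otimes>\<^bsub>A\<^esub> \<xi> (cycle3 e c a))"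
    unfolding commutator using x y x' y' by (simp add: \<xi>_comp Q_comp)
  also have "\<dots> = (\<xi> (cycle3 a b d) \<otimes>\<^bsub>A\<^esub> \<xi> (cycle3 d b a)) \<otimes>\<^bsub>A\<^esub>
      (\<xi> (cycle3 a c e) \<otimes>\<^bsub>A\<^esub> \<xi> (cycle3 e c a))"
    using x y x' y' by (intro A.mult_interchange \<xi>_closed)
  finally show ?thesis using one by simp
qed

text \<open>
  Replacing \<open>d\<close> by a fifth point \<open>e\<close> gives a conjugate element, and the product of the two is a
  \<open>3\<close>-cycle. So \<open>Q\<close> contains \<open>3\<close>-cycles, and the double transposition is a product of two of them.
\<close>

lemma \<xi>_double_transposition:
  assumes Q: "Transposition.transpose a b \<circ> Transposition.transpose c d \<in> Q"
    and abcd: "a \<in> {1..m}" "b \<in> {1..m}" "c \<in> {1..m}" "d \<in> {1..m}" "distinct [a, b, c, d]"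
  shows "\<xi> (Transposition.transpose a b \<circ> Transposition.transpose c d) = \<one>\<^bsub>A\<^esub>"
proof -
  obtain e where e: "e \<in> {1..m}" "e \<notin> {a, b, c, d}"
    using exists_fresh_index[of "{a, b, c, d}" m] m_ge_5 abcd by auto
  have comm: "Transposition.transpose a b \<circ> Transposition.transpose c d =
      Transposition.transpose c d \<circ> Transposition.transpose a b"
    using transpose_comp_transpose[of a b c d] abcd(5) by simp
  have "Transposition.transpose a b \<circ> Transposition.transpose c e \<in> Q"
    using Q_conj[OF permutes_swap_id[OF abcd(4) e(1)] Q] abcd(5) e(2)
    unfolding conj_transpose_comp_transpose[OF bij_transpose] by (auto simp: transpose_def)
  from Q_comp[OF Q this]
  have "Transposition.transpose c d \<circ> (Transposition.transpose a b \<circ> Transposition.transpose a b) \<circ>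
      Transposition.transpose c e \<in> Q"
    unfolding comm by (simp only: comp_assoc)
  then have 1: "cycle3 d c e \<in> Q"
    by (simp add: cycle3_def transpose_commute)
  have 2: "cycle3 d c b \<in> Q"
    using cycle3_conj_mem[OF 1 e(1) abcd(2)] abcd(5) e(2) by (auto simp: transpose_def)
  have 3: "cycle3 a c b \<in> Q"
    using cycle3_conj_mem[OF 2 abcd(4,1)] abcd(5) e(2) by (auto simp: transpose_def)
  have 4: "cycle3 a b c \<in> Q"
    using cycle3_conj_mem[OF 3 abcd(2,3)] abcd(5) e(2) by (auto simp: transpose_def)
  have "cycle3 d c b = cycle3 b d c"
    using abcd(5) by (intro cycle3_rotate) auto
  then have 5: "cycle3 b c d \<in> Q"
    using cycle3_conj_mem[OF _ abcd(3,4), of b d c] 2 abcd(5) by (auto simp: transpose_def)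
  have "Transposition.transpose a b \<circ> Transposition.transpose c d = cycle3 a b c \<circ> cycle3 b c d"
    by (auto simp: cycle3_def fun_eq_iff)
  then show ?thesis
    using \<xi>_comp[OF 4 5] \<xi>_cycle3[OF 4] \<xi>_cycle3[OF 5] abcd by simp
qed

lemma \<xi>_transpose_comp_transpose:
  assumes Q: "Transposition.transpose a b \<circ> Transposition.transpose c d \<in> Q"
    and abcd: "a \<in> {1..m}" "b \<in> {1..m}" "c \<in> {1..m}" "d \<in> {1..m}" "a \<noteq> b" "c \<noteq> d"
  shows "\<xi> (Transposition.transpose a b \<circ> Transposition.transpose c d) = \<one>\<^bsub>A\<^esub>"
proof -
  have "c = a \<and> d = b \<or> c = b \<and> d = a \<or> c = a \<and> d \<noteq> b \<or> c = b \<and> d \<noteq> a \<or>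
      d = a \<and> c \<noteq> b \<or> d = b \<and> c \<noteq> a \<or> distinct [a, b, c, d]"
    using abcd(5,6)
    by (cases "c = a"; cases "c = b"; cases "d = a"; cases "d = b") simp_all
  then consider "c = a" "d = b" | "c = b" "d = a" | "c = a" "d \<noteq> b" | "c = b" "d \<noteq> a"
    | "d = a" "c \<noteq> b" | "d = b" "c \<noteq> a" | "distinct [a, b, c, d]"
    by argo
  then show ?thesis
  proof cases
    case 1 then show ?thesis by (simp add: \<xi>_id)
  next
    case 2 then show ?thesis by (simp add: \<xi>_id transpose_commute)
  next
    case 3
    then have "Transposition.transpose a b \<circ> Transposition.transpose c d = cycle3 b a d"
      by (simp add: cycle3_def transpose_commute)
    then show ?thesis using \<xi>_cycle3[of b a d] Q abcd 3 by simp
  next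
    case 4
    then have "Transposition.transpose a b \<circ> Transposition.transpose c d = cycle3 a b d"
      by (simp add: cycle3_def)
    then show ?thesis using \<xi>_cycle3[of a b d] Q abcd 4 by simp
  next
    case 5
    then have "Transposition.transpose a b \<circ> Transposition.transpose c d = cycle3 b a c"
      by (simp add: cycle3_def transpose_commute)
    then show ?thesis using \<xi>_cycle3[of b a c] Q abcd 5 by simp
  next
    case 6
    then have "Transposition.transpose a b \<circ> Transposition.transpose c d = cycle3 a b c"
      by (simp add: cycle3_def transpose_commute)
    then show ?thesis using \<xi>_cycle3[of a b c] Q abcd 6 by simp
  next
    case 7
    then show ?thesis using \<xi>_double_transposition Q abcd by blast
  qed
qed

text \<open>
  The quotient of \<open>t q t\<close> by \<open>q\<close> is \<open>t\<close> times the transposition \<open>q t q\<^sup>-\<^sup>1\<close>, and \<open>\<xi>\<close> kills such a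
  product.
\<close>

lemma \<xi>_conj_transpose:
  assumes q: "q \<in> Q" and ab: "a \<in> {1..m}" "b \<in> {1..m}" "a \<noteq> b"
  defines "t \<equiv> Transposition.transpose a b"
  shows "\<xi> (t \<circ> q \<circ> t) = \<xi> q"
proof -
  have qp: "q permutes {1..m}" using q by (rule Q_permutes)
  have tqt: "t \<circ> q \<circ> t \<in> Q"
    using Q_conj[OF permutes_swap_id[OF ab(1,2)] q] by (simp add: t_def)
  define p where "p = t \<circ> Transposition.transpose (q a) (q b)"
  have p: "p = t \<circ> q \<circ> t \<circ> inv' q"
    unfolding p_def t_def conj_transpose[OF permutes_bij[OF qp], symmetric] by (simp add: o_assoc)
  then have pQ: "p \<in> Q" using Q_comp[OF tqt Q_inv[OF q]] by simp
  have "\<xi> p = \<one>\<^bsub>A\<^esub>"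
    using pQ unfolding p_def t_def
    by (intro \<xi>_transpose_comp_transpose)
      (use ab permutes_in_image[OF qp] permutes_inj[OF qp] in \<open>auto simp: inj_eq\<close>)
  moreover have "t \<circ> q \<circ> t = p \<circ> q"
    unfolding p using permutes_inv_o(2)[OF qp] by (metis comp_assoc comp_id)
  ultimately show ?thesis using \<xi>_comp[OF pQ q] q by simp
qed

text \<open>
  Transpositions generate the symmetric group, and the condition for a product follows from the
  conditions for its factors.
\<close>

lemma \<xi>_conj:
  assumes "\<tau> permutes {1..m}" "q \<in> Q"
  shows "\<xi> (\<tau> \<circ> q \<circ> inv' \<tau>) = \<xi> q"
  using assms(1) finite_atLeastAtMost
proof (induction rule: permutes_induct)
  case id
  then show ?case by simp
next
  case (swap a b p)
  let ?t = "Transposition.transpose a b"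
  have split: "?t \<circ> p \<circ> q \<circ> inv' (?t \<circ> p) = ?t \<circ> (p \<circ> q \<circ> inv' p) \<circ> ?t"
    using permutes_bij[OF swap.hyps(4)] by (simp add: o_inv_distrib o_assoc)
  show ?case
    unfolding split using \<xi>_conj_transpose[OF Q_conj[OF swap.hyps(4) assms(2)] swap.hyps(1-3)] swap.IH by (simp only:)
qed

end

lemma conj_invariant_of_hom:
  assumes "5 \<le> m" "Q \<lhd> sym_lr m" "comm_group A" "\<xi> \<in> hom ((sym_lr m) \<lparr> carrier := Q \<rparr>) A"
  shows "conj_invariant m Q \<xi>"
proof -
  interpret large_sym_normal_hom m Q A \<xi>
    using assms by (simp add: large_sym_normal_hom_def large_sym_normal_hom_axioms_def
      sym_normal_hom_def sym_normal_hom_axioms_def)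
  show ?thesis
    using \<xi>_conj by (auto simp: conj_invariant_def inv_sym_lr o_assoc)
qed

section \<open>The classification\<close>

theorem theorem4p14:
  fixes G :: "('a, 'b) monoid_scheme" and m :: nat
  assumes "group G" and "m \<ge> 3"
  shows "{H. H \<lhd> wreath_sym G m} =
      {base_type_subgroup m K | K. K \<lhd> dpower G m \<and> perm_invariant G m K} \<union>
      {hom_type_subgroup G m N Q \<xi> | N Q \<xi>.
         N \<lhd> G \<and> comm_group (G Mod N) \<and>
         Q \<lhd> sym_lr m \<and> Q \<noteq> {\<one>\<^bsub>sym_lr m\<^esub>} \<and>
         \<xi> \<in> hom ((sym_lr m) \<lparr> carrier := Q \<rparr>) (G Mod N) \<and>
         (m \<le> 4 \<longrightarrow> conj_invariant m Q \<xi>)}"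
    (is "?L = ?B \<union> ?C")
proof (intro equalityI subsetI)
  interpret group G by fact
  fix H assume "H \<in> ?L"
  then have H: "H \<lhd> wreath_sym G m" by simp
  show "H \<in> ?B \<union> ?C"
  proof (cases "\<forall>g \<sigma>. (g, \<sigma>) \<in> H \<longrightarrow> \<sigma> = id")
    case True
    then have "H = base_type_subgroup m {k. (k, id) \<in> H}"
      using base_type_subgroup_of_base_elements by blast
    then have "H \<in> ?B"
      using normal_wreath_base_part[OF H] by blast
    then show ?thesis ..
  next
    case False
    then obtain g \<sigma> where "(g, \<sigma>) \<in> H" "\<sigma> \<noteq> id" by blast
    then have "H \<in> ?C"
      by (rule normal_wreath_not_base_is_hom_type[OF H assms(2)]) blast
    then show ?thesis ..
  qed
next
  interpret group G by fact
  fix H assume "H \<in> ?B \<union> ?C"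
  then show "H \<in> ?L"
  proof
    assume "H \<in> ?B"
    then show ?thesis using base_type_subgroup_normal by blast
  next
    assume "H \<in> ?C"
    then obtain N Q \<xi> where NQ: "N \<lhd> G" "comm_group (G Mod N)" "Q \<lhd> sym_lr m"
      "\<xi> \<in> hom ((sym_lr m) \<lparr> carrier := Q \<rparr>) (G Mod N)"
      and small: "m \<le> 4 \<longrightarrow> conj_invariant m Q \<xi>" and H: "H = hom_type_subgroup G m N Q \<xi>"
      by blast
    have "conj_invariant m Q \<xi>"
    proof (cases "m \<le> 4")
      case False
      then show ?thesis using conj_invariant_of_hom[OF _ NQ(3,2,4)] by simp
    qed (use small in blast)
    then show ?thesis unfolding H using hom_type_subgroup_normal NQ by simp
  qed
qed

end
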